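(* Let $\Omega\subset\mathbb{C}$ be open, let $f:\Omega\to\mathbb{C}$ be a holomorphic function of $\tau=u+iv\in\Omega$ with $f'(\tau)\neq 0$ for all $\tau\in\Omega$, and put $$R(\tau)=\frac{1+|\tau|^2}{2}\,|f'(\tau)|,\qquad \mathbf{X}(\tau)=\bigl(\mathrm{Re}\,f(\tau),\ \mathrm{Im}\,f(\tau),\ R(\tau)\bigr)\in\mathbb{R}^3 .$$ Consider the congruence of spheres $[\mathbf{X},R]$, consisting of the spheres of radius $R(\tau)$ centered at $\mathbf{X}(\tau)$, one of whose envelopes is $\tau\mapsto(\mathrm{Re}\,f(\tau),\mathrm{Im}\,f(\tau),0)$, contained in the plane $\{z=0\}$. Then its second envelope is the map $\tau\mapsto(x,y,z)$ given by $$x=\mathrm{Re}\,f-\frac{|f'|^2\,\mathrm{Re}(f'\tau)+\frac{1+|\tau|^2}{2}\,\mathrm{Re}\bigl((f')^2\overline{f''}\bigr)}{|f'|^2+\mathrm{Re}\bigl(f'\,\overline{f''}\,\overline{\tau}\bigr)+\frac{|f''|^2(|\tau|^2+1)}{4}},$$ $$y=\mathrm{Im}\,f-\frac{|f'|^2\,\mathrm{Im}(f'\tau)+\frac{1+|\tau|^2}{2}\,\mathrm{Im}\bigl((f')^2\overline{f''}\bigr)}{|f'|^2+\mathrm{Re}\bigl(f'\,\overline{f''}\,\overline{\tau}\bigr)+\frac{|f''|^2(|\tau|^2+1)}{4}},$$ $$z=\frac{|f'|^3}{|f'|^2+\mathrm{Re}\bigl(f'\,\overline{f''}\,\overline{\tau}\bigr)+\frac{|f''|^2(|\tau|^2+1)}{4}},$$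 and this map is a parametrization, in terms of $f$, of a CMC-1 surface in the upper half-space model of $\mathbb{H}^3(-1)$.
   Context: The hyperbolic space $\mathbb{H}^3(-1)$ (constant sectional curvature $-1$) is realized as the upper half-space $\{(x,y,z)\in\mathbb{R}^3: z>0\}$ with metric $(dx^2+dy^2+dz^2)/z^2$. A CMC-1 surface is a surface in $\mathbb{H}^3(-1)$ with constant mean curvature equal to $1$. A congruence of spheres $[\mathbf{X},R]$ is a smooth two-parameter family of spheres in Euclidean $\mathbb{R}^3$, with parameters $(u,v)$, whose centers $\mathbf{X}(u,v)$ describe a regular surface and whose radii are $R(u,v)$. An envelope of $[\mathbf{X},R]$ is a surface $\xi=\xi(u,v)$ such that, for each $(u,v)$, the point $\xi(u,v)$ lies on the sphere of center $\mathbf{X}(u,v)$ and radius $R(u,v)$, and the surface is tangent to that sphere there; this is expressed as $\xi=\mathbf{X}-R\nu$ with $|\nu|=1$ and $\langle\nu,\xi_u\rangle=\langle\nu,\xi_v\rangle=0$. Envelopes are allowed to degenerate to a point. Generically there are two envelopes. All of $f$, $f'=df/d\tau$, $f''=d^2f/d\tau^2$ in the formulas are evaluated at $\tau$, and the bar denotes complex conjugation. *)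

theory Defs
  imports "HOL-Complex_Analysis.Complex_Analysis"
begin

section \<open>Smooth maps on open sets\<close>

primrec Ck_on :: "nat \<Rightarrow> 'a::real_normed_vector set \<Rightarrow> ('a \<Rightarrow> 'b::real_normed_vector) \<Rightarrow> bool" where
  "Ck_on 0 S f \<longleftrightarrow> continuous_on S f"
| "Ck_on (Suc k) S f \<longleftrightarrow> (\<forall>x\<in>S. f differentiable (at x)) \<and>
     (\<forall>v. Ck_on k S (\<lambda>x. frechet_derivative f (at x) v))"

text \<open>Meant for open sets only, because of the derivatives \<open>at x\<close> in full neighbourhoods.\<close>

definition smooth_on :: "'a::real_normed_vector set \<Rightarrow> ('a \<Rightarrow> 'b::real_normed_vector) \<Rightarrow> bool" where
  "smooth_on S f \<longleftrightarrow> (\<forall>k. Ck_on k S f)"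

section \<open>Parametrized surfaces\<close>

text \<open>The parameters \<open>(u, v)\<close> are encoded as \<open>\<tau> = u + \<i> v\<close>, so the partial derivatives in \<open>u\<close> and
  \<open>v\<close> are the derivatives in the directions \<open>1\<close> and \<open>\<i>\<close>.\<close>

definition d_dir :: "complex \<Rightarrow> (complex \<Rightarrow> 'b::real_normed_vector) \<Rightarrow> complex \<Rightarrow> 'b" where
  "d_dir a \<xi> \<tau> = frechet_derivative \<xi> (at \<tau>) a"

abbreviation d_u :: "(complex \<Rightarrow> 'b::real_normed_vector) \<Rightarrow> complex \<Rightarrow> 'b" where
  "d_u \<equiv> d_dir 1"

abbreviation d_v :: "(complex \<Rightarrow> 'b::real_normed_vector) \<Rightarrow> complex \<Rightarrow> 'b" where
  "d_v \<equiv> d_dir \<i>"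

definition regular_at :: "(complex \<Rightarrow> real^'n) \<Rightarrow> complex \<Rightarrow> bool" where
  "regular_at \<xi> \<tau> \<longleftrightarrow> \<xi> differentiable (at \<tau>) \<and> inj (frechet_derivative \<xi> (at \<tau>))"

section \<open>Congruences of spheres and their envelopes\<close>

definition sphere_congruence_on ::
    "complex set \<Rightarrow> (complex \<Rightarrow> real^3) \<Rightarrow> (complex \<Rightarrow> real) \<Rightarrow> bool" where
  "sphere_congruence_on \<Omega> X R \<longleftrightarrow>
     smooth_on \<Omega> X \<and> smooth_on \<Omega> R \<and> (\<forall>\<tau>\<in>\<Omega>. regular_at X \<tau> \<and> R \<tau> > 0)"

text \<open>An envelope is not required to be regular: it may degenerate, even to a point.\<close>

definition envelope_on ::
    "complex set \<Rightarrow> (complex \<Rightarrow> real^3) \<Rightarrow> (complex \<Rightarrow> real) \<Rightarrow> (complex \<Rightarrow> real^3) \<Rightarrow> bool" where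
  "envelope_on \<Omega> X R \<xi> \<longleftrightarrow> smooth_on \<Omega> \<xi> \<and>
     (\<exists>\<nu>. \<forall>\<tau>\<in>\<Omega>. norm (\<nu> \<tau>) = 1 \<and> \<xi> \<tau> = X \<tau> - R \<tau> *\<^sub>R \<nu> \<tau> \<and>
        \<nu> \<tau> \<bullet> d_u \<xi> \<tau> = 0 \<and> \<nu> \<tau> \<bullet> d_v \<xi> \<tau> = 0)"

section \<open>Mean curvature with respect to a Riemannian metric\<close>

text \<open>A metric on a region of \<open>\<real>\<^sup>n\<close> is given by its matrix of coefficients at each point.\<close>

type_synonym 'n metric = "real^'n \<Rightarrow> real^'n^'n"

definition metric_inner :: "'n::finite metric \<Rightarrow> real^'n \<Rightarrow> real^'n \<Rightarrow> real^'n \<Rightarrow> real" where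
  "metric_inner g p a b = (\<Sum>i\<in>UNIV. \<Sum>j\<in>UNIV. g p $ i $ j * a $ i * b $ j)"

definition partial :: "'n::finite \<Rightarrow> (real^'n \<Rightarrow> real) \<Rightarrow> real^'n \<Rightarrow> real" where
  "partial i F p = frechet_derivative F (at p) (axis i 1)"

text \<open>\<open>christoffel g p k i j\<close> is the symbol with upper index \<open>k\<close> and lower indices \<open>i\<close>, \<open>j\<close> of the
  Levi-Civita connection of \<open>g\<close>.\<close>

definition christoffel :: "'n::finite metric \<Rightarrow> real^'n \<Rightarrow> 'n \<Rightarrow> 'n \<Rightarrow> 'n \<Rightarrow> real" where
  "christoffel g p k i j = (1/2) * (\<Sum>l\<in>UNIV. matrix_inv (g p) $ k $ l *
     (partial i (\<lambda>q. g q $ j $ l) p + partial j (\<lambda>q. g q $ i $ l) p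
        - partial l (\<lambda>q. g q $ i $ j) p))"

text \<open>Covariant derivative, in the parameter direction \<open>a\<close>, of a vector field \<open>V\<close> along \<open>\<xi>\<close>.\<close>

definition cov_deriv :: "'n::finite metric \<Rightarrow> (complex \<Rightarrow> real^'n) \<Rightarrow> complex \<Rightarrow>
    (complex \<Rightarrow> real^'n) \<Rightarrow> complex \<Rightarrow> real^'n" where
  "cov_deriv g \<xi> a V \<tau> = (\<chi> k. d_dir a V \<tau> $ k +
     (\<Sum>i\<in>UNIV. \<Sum>j\<in>UNIV. christoffel g (\<xi> \<tau>) k i j * d_dir a \<xi> \<tau> $ i * V \<tau> $ j))"

definition first_form :: "'n::finite metric \<Rightarrow> (complex \<Rightarrow> real^'n) \<Rightarrow> complex \<Rightarrow>
    complex \<Rightarrow> complex \<Rightarrow> real" where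
  "first_form g \<xi> \<tau> a b = metric_inner g (\<xi> \<tau>) (d_dir a \<xi> \<tau>) (d_dir b \<xi> \<tau>)"

definition second_form :: "'n::finite metric \<Rightarrow> (complex \<Rightarrow> real^'n) \<Rightarrow> (complex \<Rightarrow> real^'n) \<Rightarrow>
    complex \<Rightarrow> complex \<Rightarrow> complex \<Rightarrow> real" where
  "second_form g \<xi> N \<tau> a b = metric_inner g (\<xi> \<tau>) (cov_deriv g \<xi> a (d_dir b \<xi>) \<tau>) (N \<tau>)"

definition unit_normal_on :: "'n::finite metric \<Rightarrow> complex set \<Rightarrow> (complex \<Rightarrow> real^'n) \<Rightarrow>
    (complex \<Rightarrow> real^'n) \<Rightarrow> bool" where
  "unit_normal_on g W \<xi> N \<longleftrightarrow> (\<forall>\<tau>\<in>W. metric_inner g (\<xi> \<tau>) (N \<tau>) (N \<tau>) = 1 \<and>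
     metric_inner g (\<xi> \<tau>) (d_u \<xi> \<tau>) (N \<tau>) = 0 \<and> metric_inner g (\<xi> \<tau>) (d_v \<xi> \<tau>) (N \<tau>) = 0)"

text \<open>Half the trace of the second fundamental form with respect to the first, that is, the mean
  (not the sum) of the principal curvatures; horospheres have mean curvature 1 in this
  normalization.\<close>

definition mean_curvature :: "'n::finite metric \<Rightarrow> (complex \<Rightarrow> real^'n) \<Rightarrow> (complex \<Rightarrow> real^'n) \<Rightarrow>
    complex \<Rightarrow> real" where
  "mean_curvature g \<xi> N \<tau> =
     (let I = first_form g \<xi> \<tau>; II = second_form g \<xi> N \<tau> in
       (I 1 1 * II \<i> \<i> - 2 * I 1 \<i> * II 1 \<i> + I \<i> \<i> * II 1 1)
         / (2 * (I 1 1 * I \<i> \<i> - (I 1 \<i>)\<^sup>2)))"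

section \<open>Surfaces of constant mean curvature in the upper half-space model\<close>

definition hyp_metric :: "3 metric" where
  "hyp_metric p = (\<chi> i j. if i = j then 1 / (p $ 3)\<^sup>2 else 0)"

definition cmc_immersion_on :: "real \<Rightarrow> complex set \<Rightarrow> (complex \<Rightarrow> real^3) \<Rightarrow> bool" where
  "cmc_immersion_on c W \<xi> \<longleftrightarrow>
     smooth_on W \<xi> \<and> (\<forall>\<tau>\<in>W. \<xi> \<tau> $ 3 > 0 \<and> regular_at \<xi> \<tau>) \<and>
     (\<exists>N. smooth_on W N \<and> unit_normal_on hyp_metric W \<xi> N \<and>
        (\<forall>\<tau>\<in>W. mean_curvature hyp_metric \<xi> N \<tau> = c))"

text \<open>A parametrization may have singular points, where the mean curvature is undefined; the
  condition on the mean curvature concerns the set of all regular points.\<close>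

definition cmc_parametrization_on :: "real \<Rightarrow> complex set \<Rightarrow> (complex \<Rightarrow> real^3) \<Rightarrow> bool" where
  "cmc_parametrization_on c \<Omega> \<xi> \<longleftrightarrow>
     smooth_on \<Omega> \<xi> \<and> (\<forall>\<tau>\<in>\<Omega>. \<xi> \<tau> $ 3 > 0) \<and>
     cmc_immersion_on c {\<tau>\<in>\<Omega>. regular_at \<xi> \<tau>} \<xi>"

end

theory Submission
  imports Defs
begin

text \<open>
  Each sphere has its centre at height \<open>R\<close>, so it is tangent to the plane at infinity
  \<open>z = 0\<close> at the point \<open>f \<tau>\<close>: the congruence consists of horospheres. With \<open>\<real>\<^sup>3\<close> read as
  \<open>\<complex> \<times> \<real>\<close>, everything is governed by the holomorphic function \<open>q = f'' / (2 f')\<close> through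
  \<open>A = \<tau> + (1 + \<bar>\<tau>\<bar>\<^sup>2) cnj q\<close>, \<open>D = \<bar>1 + \<tau> q\<bar>\<^sup>2 + \<bar>q\<bar>\<^sup>2\<close> and half the Schwarzian derivative
  \<open>S = q' - q\<^sup>2\<close> of \<open>f\<close>. The denominator of the second envelope is \<open>\<bar>f'\<bar>\<^sup>2 D\<close>, hence positive,
  and the envelope itself is \<open>\<xi> = (f - f' A / D, \<bar>f'\<bar> / D)\<close>.

  \<^bold>\<open>The envelopes.\<close> Along an envelope \<open>\<eta>\<close>, differentiating \<open>\<bar>X - \<eta>\<bar>\<^sup>2 = R\<^sup>2\<close> in a direction
  \<open>a\<close> and using that \<open>X - \<eta>\<close> is normal to \<open>\<eta>\<close> gives \<open>(X - \<eta>) \<bullet> X\<^sub>a = R R\<^sub>a\<close>. For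
  \<open>X - \<eta> = (w, s)\<close> this expresses \<open>w\<close> linearly through \<open>R - s\<close>, and the equation of the
  sphere becomes a quadratic equation for \<open>s\<close>, with one root for the plane and one for \<open>\<xi>\<close>
  (\<open>envelope_point_cases\<close>).

  \<^bold>\<open>The second envelope.\<close> A computation with conjugate variables shows that the derivative
  of \<open>\<xi>\<close> in direction \<open>a\<close> depends only on \<open>\<sigma> = S a\<close>: it is
  \<open>D\<^sup>-\<^sup>2 (f' (A\<^sup>2 \<sigma> - cnj \<sigma>), -2 \<bar>f'\<bar> Re (A \<sigma>))\<close> (\<open>has_derivative_\<xi>\<close>). From this formula the
  tangency to the spheres is an identity in \<open>A\<close> and \<open>\<sigma>\<close>, and so is the conformality of \<open>\<xi>\<close>.

  \<^bold>\<open>The mean curvature.\<close> With \<open>N\<close> the unit normal that points to the centres of the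
  horospheres, differentiating \<open>\<xi>\<^sub>b \<bullet> (X - \<xi>) = 0\<close> turns the hyperbolic second fundamental form
  into \<open>II(a, b) = I(a, b) - (X\<^sub>a \<bullet> \<xi>\<^sub>b) / (z R)\<close> (\<open>second_form_horospheres\<close>), without a second
  derivative of \<open>\<xi>\<close>. The first summand alone is the form of a horosphere, of mean curvature 1.
  The second contributes nothing to the trace: \<open>\<xi>\<close> is conformal, and
  \<open>X\<^sub>u \<bullet> \<xi>\<^sub>u + X\<^sub>v \<bullet> \<xi>\<^sub>v = 0\<close> (\<open>trace_zero\<close>).
\<close>

(* Here $ always selects a component of a vector. *)
no_notation fps_nth (infixl "$" 75)

section \<open>Closure properties of maps of class C^k\<close>

text \<open>Two functions that agree on an open set have the same derivatives there, so a derivative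
  computed by rules that hold only on the set may replace the Frechet derivative on all of the
  space. Openness of the set enters the closure properties below through this lemma.\<close>

lemma Ck_on_cong:
  assumes "open S" and "\<And>x. x \<in> S \<Longrightarrow> f x = g x" and "Ck_on k S f"
  shows "Ck_on k S g"
  using assms(2,3)
proof (induction k arbitrary: f g)
  case 0
  then show ?case by (simp cong: continuous_on_cong)
next
  case (Suc k)
  have D: "(g has_derivative frechet_derivative f (at x)) (at x)" if "x \<in> S" for x
  proof (rule has_derivative_transform_within_open[OF _ \<open>open S\<close> that])
    show "(f has_derivative frechet_derivative f (at x)) (at x)"
      using Suc.prems(2) that by (auto simp: frechet_derivative_works)
  qed (use Suc.prems in auto)
  have "Ck_on k S (\<lambda>x. frechet_derivative g (at x) v)" for v
  proof (rule Suc.IH)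
    show "frechet_derivative f (at x) v = frechet_derivative g (at x) v" if "x \<in> S" for x
      using frechet_derivative_at[OF D[OF that]] by simp
  qed (use Suc.prems(2) in simp)
  then show ?case
    using D by (auto simp: differentiable_def)
qed

text \<open>The induction step of all closure properties: it suffices to exhibit some derivative
  whose values in every direction are again of class C^k.\<close>

lemma Ck_on_derivI:
  assumes "open S"
    and "\<And>x. x \<in> S \<Longrightarrow> (f has_derivative D x) (at x)"
    and "\<And>v. Ck_on k S (\<lambda>x. D x v)"
  shows "Ck_on (Suc k) S f"
proof -
  have "D x v = frechet_derivative f (at x) v" if "x \<in> S" for x v
    using frechet_derivative_at[OF assms(2)[OF that]] by simp
  then have "Ck_on k S (\<lambda>x. frechet_derivative f (at x) v)" for v
    by (rule Ck_on_cong[OF \<open>open S\<close> _ assms(3)])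
  then show ?thesis
    using assms(2) by (auto simp: differentiable_def)
qed

lemma Ck_on_has_derivative:
  assumes "Ck_on (Suc k) S f" "x \<in> S"
  shows "(f has_derivative frechet_derivative f (at x)) (at x)"
  using assms by (auto simp: frechet_derivative_works)

lemma Ck_on_deriv:
  "Ck_on (Suc k) S f \<Longrightarrow> Ck_on k S (\<lambda>x. frechet_derivative f (at x) v)"
  by simp

lemma Ck_on_pred: "Ck_on (Suc k) S f \<Longrightarrow> Ck_on k S f"
proof (induction k arbitrary: f)
  case 0
  then show ?case
    by (auto intro!: differentiable_imp_continuous_on simp: differentiable_on_def differentiable_at_withinI)
next
  case (Suc k)
  then have "Ck_on k S (\<lambda>x. frechet_derivative f (at x) v)" for v by (simp del: Ck_on.simps(2) add: Ck_on_deriv)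
  with Suc.prems show ?case by simp
qed

lemma Ck_on_subset: "Ck_on k S f \<Longrightarrow> T \<subseteq> S \<Longrightarrow> Ck_on k T f"
  by (induction k arbitrary: f) (auto intro: continuous_on_subset)

lemma Ck_on_const: "open S \<Longrightarrow> Ck_on k S (\<lambda>x. c)"
proof (induction k arbitrary: c)
  case (Suc k)
  then show ?case by (intro Ck_on_derivI[where D="\<lambda>_ _. 0"]) auto
qed simp

lemma Ck_on_linear:
  assumes "open S" "bounded_linear L" "Ck_on k S f"
  shows "Ck_on k S (\<lambda>x. L (f x))"
  using assms(3)
proof (induction k arbitrary: f)
  case 0
  then show ?case by (simp add: bounded_linear.continuous_on[OF assms(2)])
next
  case (Suc k)
  show ?case
  proof (rule Ck_on_derivI[OF \<open>open S\<close>])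
    show "((\<lambda>x. L (f x)) has_derivative (\<lambda>v. L (frechet_derivative f (at x) v))) (at x)" if "x \<in> S" for x
      by (rule bounded_linear.has_derivative[OF assms(2) Ck_on_has_derivative[OF Suc.prems that]])
    show "Ck_on k S (\<lambda>x. L (frechet_derivative f (at x) v))" for v
      by (rule Suc.IH[OF Ck_on_deriv[OF Suc.prems]])
  qed
qed

lemma Ck_on_add:
  assumes "open S" "Ck_on k S f" "Ck_on k S g"
  shows "Ck_on k S (\<lambda>x. f x + g x)"
  using assms(2,3)
proof (induction k arbitrary: f g)
  case (Suc k)
  show ?case
  proof (rule Ck_on_derivI[OF \<open>open S\<close>])
    show "((\<lambda>x. f x + g x) has_derivative (\<lambda>v. frechet_derivative f (at x) v + frechet_derivative g (at x) v)) (at x)"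
      if "x \<in> S" for x
      by (intro has_derivative_add Ck_on_has_derivative[OF Suc.prems(1) that] Ck_on_has_derivative[OF Suc.prems(2) that])
    show "Ck_on k S (\<lambda>x. frechet_derivative f (at x) v + frechet_derivative g (at x) v)" for v
      by (rule Suc.IH[OF Ck_on_deriv[OF Suc.prems(1)] Ck_on_deriv[OF Suc.prems(2)]])
  qed
qed (auto intro: continuous_on_add)

lemma Ck_on_diff:
  assumes "open S" "Ck_on k S f" "Ck_on k S g"
  shows "Ck_on k S (\<lambda>x. f x - g x)"
  using Ck_on_add[OF assms(1,2) Ck_on_linear[OF assms(1) bounded_linear_minus[OF bounded_linear_ident] assms(3)]]
  by simp

lemma Ck_on_bilinear:
  assumes "open S" "bounded_bilinear B" "Ck_on k S f" "Ck_on k S g"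
  shows "Ck_on k S (\<lambda>x. B (f x) (g x))"
  using assms(3,4)
proof (induction k arbitrary: f g)
  case 0
  then show ?case by (simp add: bounded_bilinear.continuous_on[OF assms(2)])
next
  case (Suc k)
  show ?case
  proof (rule Ck_on_derivI[OF \<open>open S\<close>])
    show "((\<lambda>x. B (f x) (g x)) has_derivative
       (\<lambda>v. B (f x) (frechet_derivative g (at x) v) + B (frechet_derivative f (at x) v) (g x))) (at x)"
      if "x \<in> S" for x
      by (intro bounded_bilinear.FDERIV[OF assms(2)] Ck_on_has_derivative[OF Suc.prems(1) that] Ck_on_has_derivative[OF Suc.prems(2) that])
    show "Ck_on k S (\<lambda>x. B (f x) (frechet_derivative g (at x) v) + B (frechet_derivative f (at x) v) (g x))" for v
      by (intro Ck_on_add[OF \<open>open S\<close>] Suc.IH Ck_on_deriv[OF Suc.prems(1)] Ck_on_deriv[OF Suc.prems(2)]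
          Ck_on_pred[OF Suc.prems(1)] Ck_on_pred[OF Suc.prems(2)])
  qed
qed

lemma Ck_on_inverse:
  fixes f :: "'a::real_normed_vector \<Rightarrow> 'b::real_normed_field"
  assumes "open S" "\<And>x. x \<in> S \<Longrightarrow> f x \<noteq> 0" "Ck_on k S f"
  shows "Ck_on k S (\<lambda>x. inverse (f x))"
  using assms(3)
proof (induction k)
  case 0
  then show ?case by (auto intro!: continuous_on_inverse simp: assms(2))
next
  case (Suc k)
  show ?case
  proof (rule Ck_on_derivI[OF \<open>open S\<close>])
    show "((\<lambda>x. inverse (f x)) has_derivative
        (\<lambda>v. - (inverse (f x) * frechet_derivative f (at x) v * inverse (f x)))) (at x)"
      if "x \<in> S" for x
      by (rule Deriv.has_derivative_inverse[OF assms(2)[OF that] Ck_on_has_derivative[OF Suc.prems that]])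
    show "Ck_on k S (\<lambda>x. - (inverse (f x) * frechet_derivative f (at x) v * inverse (f x)))" for v
      by (intro Ck_on_linear[OF \<open>open S\<close> bounded_linear_minus[OF bounded_linear_ident]]
          Ck_on_bilinear[OF \<open>open S\<close> bounded_bilinear_mult] Suc.IH Ck_on_pred[OF Suc.prems] Ck_on_deriv[OF Suc.prems])
  qed
qed

lemma Ck_on_sqrt:
  assumes "open S" "\<And>x. x \<in> S \<Longrightarrow> f x > 0" "Ck_on k S f"
  shows "Ck_on k S (\<lambda>x. sqrt (f x))"
  using assms(3)
proof (induction k)
  case 0
  then show ?case by (auto intro!: continuous_on_real_sqrt)
next
  case (Suc k)
  show ?case
  proof (rule Ck_on_derivI[OF \<open>open S\<close>])
    show "((\<lambda>x. sqrt (f x)) has_derivative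
        (\<lambda>v. frechet_derivative f (at x) v * (inverse (sqrt (f x)) / 2))) (at x)"
      if "x \<in> S" for x
      by (rule has_derivative_real_sqrt[OF assms(2)[OF that] Ck_on_has_derivative[OF Suc.prems that]])
    have "sqrt (f x) \<noteq> 0" if "x \<in> S" for x using assms(2)[OF that] by simp
    then show "Ck_on k S (\<lambda>x. frechet_derivative f (at x) v * (inverse (sqrt (f x)) / 2))" for v
      by (intro Ck_on_bilinear[OF \<open>open S\<close> bounded_bilinear_mult] Ck_on_inverse
          Ck_on_linear[OF \<open>open S\<close> bounded_linear_divide[of 2]]
          Suc.IH Ck_on_pred[OF Suc.prems] Ck_on_deriv[OF Suc.prems] \<open>open S\<close>)
  qed
qed

lemma Ck_on_holomorphic:
  assumes "open S" "f holomorphic_on S"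
  shows "Ck_on k S f"
  using assms(2)
proof (induction k arbitrary: f)
  case 0
  then show ?case by (simp add: holomorphic_on_imp_continuous_on)
next
  case (Suc k)
  show ?case
  proof (rule Ck_on_derivI[OF \<open>open S\<close>])
    show "(f has_derivative (\<lambda>v. deriv f x * v)) (at x)" if "x \<in> S" for x
      using holomorphic_derivI[OF Suc.prems \<open>open S\<close> that] by (simp add: has_field_derivative_def)
    show "Ck_on k S (\<lambda>x. deriv f x * v)" for v
      by (intro Suc.IH holomorphic_intros Suc.prems \<open>open S\<close>)
  qed
qed

section \<open>Three-space as the product of the complex plane and the line of heights\<close>

definition pt :: "complex \<Rightarrow> real \<Rightarrow> real^3" where
  "pt w h = vector [Re w, Im w, h]"

lemma pt_nth [simp]: "pt w h $ 1 = Re w" "pt w h $ 2 = Im w" "pt w h $ 3 = h"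
  by (simp_all add: pt_def)

lemma pt_cases: obtains w h where "x = pt w h"
proof
  show "x = pt (Complex (x $ 1) (x $ 2)) (x $ 3)"
    by (simp add: vec_eq_iff forall_3)
qed

lemma pt_eq_iff: "pt w h = pt w' h' \<longleftrightarrow> w = w' \<and> h = h'"
  by (auto simp: vec_eq_iff forall_3 complex_eq_iff)

lemma pt_add: "pt w h + pt w' h' = pt (w + w') (h + h')"
  and pt_diff: "pt w h - pt w' h' = pt (w - w') (h - h')"
  and pt_scaleR: "r *\<^sub>R pt w h = pt (of_real r * w) (r * h)"
  by (simp_all add: vec_eq_iff forall_3)

lemma inner_pt: "pt w h \<bullet> pt w' h' = Re (cnj w * w') + h * h'"
  by (simp add: inner_vec_def sum_3)

text \<open>Rotations about the vertical axis preserve inner products; the phase of \<open>f'\<close> enters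
  all vectors of the construction as such a rotation.\<close>

lemma inner_rotated:
  assumes "c \<noteq> 0"
  shows "pt (sgn c * z) h \<bullet> pt (sgn c * w) k = Re (cnj z * w) + h * k"
proof -
  have "cnj (sgn c) * sgn c = 1"
    using assms complex_norm_square[of "sgn c"] by (simp add: norm_sgn mult.commute)
  then have "cnj (sgn c * z) * (sgn c * w) = cnj z * w"
    by (simp add: mult_ac)
  then show ?thesis
    by (simp only: inner_pt)
qed

lemma bounded_linear_pt: "bounded_linear (\<lambda>x. pt (fst x) (snd x))"
proof (rule linear_conv_bounded_linear[THEN iffD1], rule linearI)
qed (simp_all add: pt_add pt_scaleR scaleR_conv_of_real[where 'a=complex])

lemma has_derivative_pt:
  assumes "(w has_derivative w') (at x within S)" "(h has_derivative h') (at x within S)"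
  shows "((\<lambda>x. pt (w x) (h x)) has_derivative (\<lambda>v. pt (w' v) (h' v))) (at x within S)"
  using bounded_linear.has_derivative[OF bounded_linear_pt has_derivative_Pair[OF assms]] by simp

lemma Ck_on_pt:
  assumes S: "open S" and w: "Ck_on k S w" and h: "Ck_on k S h"
  shows "Ck_on k S (\<lambda>x. pt (w x) (h x))"
proof -
  have 1: "bounded_linear (\<lambda>w. pt w 0)" "bounded_linear (\<lambda>h. pt 0 h)"
    using bounded_linear_compose[OF bounded_linear_pt bounded_linear_Pair[OF bounded_linear_ident bounded_linear_zero]]
     bounded_linear_compose[OF bounded_linear_pt bounded_linear_Pair[OF bounded_linear_zero bounded_linear_ident]]
    by (simp_all add: o_def)
  have "Ck_on k S (\<lambda>x. pt (w x) 0 + pt 0 (h x))"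
    by (intro Ck_on_add[OF S] Ck_on_linear[OF S 1(1) w] Ck_on_linear[OF S 1(2) h])
  then show ?thesis by (simp add: pt_add)
qed

section \<open>Covariant derivatives in the upper half-space\<close>

lemma matrix_inv_eqI:
  fixes A :: "'a::semiring_1^'n^'m"
  assumes "A ** B = mat 1" "B ** A = mat 1"
  shows "matrix_inv A = B"
proof -
  have "invertible A"
    using assms unfolding invertible_def by blast
  then have "matrix_inv A ** A = mat 1"
    unfolding invertible_def matrix_inv_def by (rule someI2_ex) simp
  then have "matrix_inv A ** (A ** B) = B"
    by (simp add: matrix_mul_assoc)
  then show ?thesis
    using assms(1) by simp
qed

lemma partial_hyp_metric:
  assumes "p $ 3 > 0"
  shows "partial i (\<lambda>q. hyp_metric q $ j $ l) p = (if j = l \<and> i = 3 then - 2 / (p $ 3) ^ 3 else 0)"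
proof (cases "j = l")
  case True
  have "((\<lambda>t::real. 1 / t\<^sup>2) has_derivative (\<lambda>h. h * (- 2 / (p $ 3) ^ 3))) (at (p $ 3))"
    using assms
    by (auto intro!: derivative_eq_intros simp: power2_eq_square power3_eq_cube field_simps)
  from has_derivative_compose[OF bounded_linear_imp_has_derivative[OF bounded_linear_vec_nth] this]
  have "((\<lambda>q::real^3. 1 / (q $ 3)\<^sup>2) has_derivative (\<lambda>v. v $ 3 * (- 2 / (p $ 3) ^ 3))) (at p)" .
  note D = frechet_derivative_at[OF this, symmetric]
  have "partial i (\<lambda>q. hyp_metric q $ j $ l) p = axis i 1 $ 3 * (- 2 / (p $ 3) ^ 3)"
    using True by (simp add: partial_def hyp_metric_def D)
  then show ?thesis
    using True by (simp add: axis_def)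
next
  case False
  then show ?thesis by (simp add: partial_def hyp_metric_def)
qed

lemma matrix_inv_hyp_metric:
  assumes "p $ 3 > 0"
  shows "matrix_inv (hyp_metric p) = (\<chi> i j. if i = j then (p $ 3)\<^sup>2 else 0)"
proof -
  have diag: "(\<chi> i j. if i = j then a else 0) ** (\<chi> i j. if i = j then b else 0)
      = (\<chi> i j::3. if i = j then a * b else (0::real))" for a b
    by (simp add: matrix_matrix_mult_def vec_eq_iff forall_3 sum_3)
  show ?thesis
    by (rule matrix_inv_eqI) (use assms in \<open>simp_all add: hyp_metric_def diag mat_def cong: if_cong\<close>)
qed

lemma christoffel_hyp_metric:
  assumes "p $ 3 > 0"
  shows "christoffel hyp_metric p k i j =
    (of_bool (i = j \<and> k = 3) - of_bool (j = k \<and> i = 3) - of_bool (i = k \<and> j = 3)) / p $ 3"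
proof -
  have "(1/2) * (z\<^sup>2 * ((if P then - 2 / z ^ 3 else 0) + (if Q then - 2 / z ^ 3 else 0) - (if U then - 2 / z ^ 3 else 0)))
      = (of_bool U - of_bool P - of_bool Q) / z" if "z > 0" for z :: real and P Q U
    using that by (cases P; cases Q; cases U) (simp_all add: field_simps power2_eq_square power3_eq_cube)
  note scale = this[OF assms]
  have "christoffel hyp_metric p k i j = (1/2) * (\<Sum>l\<in>UNIV. if k = l then
      (p$3)\<^sup>2 * ((if j = l \<and> i = 3 then - 2 / (p$3) ^ 3 else 0)
        + (if i = l \<and> j = 3 then - 2 / (p$3) ^ 3 else 0)
        - (if i = j \<and> l = 3 then - 2 / (p$3) ^ 3 else 0)) else 0)"
    unfolding christoffel_def matrix_inv_hyp_metric[OF assms] partial_hyp_metric[OF assms] vec_lambda_beta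
    by (intro arg_cong[where f="\<lambda>x. 1/2*x"] sum.cong refl) (simp only: if_distribR mult_zero_left split: if_split, blast)
  also have "\<dots> = (of_bool (i = j \<and> k = 3) - of_bool (j = k \<and> i = 3) - of_bool (i = k \<and> j = 3)) / p $ 3"
    unfolding sum.delta'[OF finite] scale[symmetric] by simp
  finally show ?thesis .
qed

lemma metric_inner_hyp: "metric_inner hyp_metric p a b = (a \<bullet> b) / (p $ 3)\<^sup>2"
  by (simp add: metric_inner_def hyp_metric_def inner_vec_def sum_3 add_divide_distrib)

text \<open>The metric is \<open>1/z\<^sup>2\<close> times the Euclidean one, and this is the usual correction of the
  flat connection under a conformal change, with \<open>d (ln z) = dz / z\<close>.\<close>

lemma cov_deriv_hyp:
  assumes "\<xi> \<tau> $ 3 > 0"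
  shows "cov_deriv hyp_metric \<xi> a V \<tau> = d_dir a V \<tau> +
    (1 / \<xi> \<tau> $ 3) *\<^sub>R ((d_dir a \<xi> \<tau> \<bullet> V \<tau>) *\<^sub>R axis 3 1
       - (V \<tau> $ 3) *\<^sub>R d_dir a \<xi> \<tau> - (d_dir a \<xi> \<tau> $ 3) *\<^sub>R V \<tau>)"
proof -
  have "(\<Sum>i\<in>UNIV. \<Sum>j\<in>UNIV. (of_bool (i = j \<and> k = 3) - of_bool (j = k \<and> i = 3) - of_bool (i = k \<and> j = 3)) / z * v $ i * w $ j)
    = (1 / z) * ((v \<bullet> w) * (axis 3 1 $ k) - w $ 3 * v $ k - v $ 3 * w $ k)" for v w :: "real^3" and z :: real and k :: 3
  proof -
    have "(\<Sum>i\<in>UNIV. \<Sum>j\<in>UNIV. (of_bool (i = j \<and> k = 3) - of_bool (j = k \<and> i = 3) - of_bool (i = k \<and> j = 3)) / z * v $ i * w $ j)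
     = (1 / z) * (\<Sum>i\<in>UNIV. \<Sum>j\<in>UNIV. (of_bool (i = j \<and> k = 3) - of_bool (j = k \<and> i = 3) - of_bool (i = k \<and> j = 3)) * v $ i * w $ j)"
      by (simp add: sum_distrib_left)
    also have "(\<Sum>i\<in>UNIV. \<Sum>j\<in>UNIV. (of_bool (i = j \<and> k = 3) - of_bool (j = k \<and> i = 3) - of_bool (i = k \<and> j = 3)) * v $ i * w $ j)
      = (v \<bullet> w) * (axis 3 1 $ k) - w $ 3 * v $ k - v $ 3 * w $ k"
      using exhaust_3[of k] by (auto simp: sum_3 inner_vec_def axis_def)
    finally show ?thesis .
  qed
  note sums = this
  show ?thesis
    unfolding cov_deriv_def christoffel_hyp_metric[OF assms] sums
    by (simp add: vec_eq_iff)
qed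

text \<open>Pairing with a normal vector removes the two tangential terms of the correction.\<close>

lemma second_form_hyp:
  assumes "\<xi> \<tau> $ 3 > 0" "d_dir a \<xi> \<tau> \<bullet> N \<tau> = 0" "d_dir b \<xi> \<tau> \<bullet> N \<tau> = 0"
  shows "second_form hyp_metric \<xi> N \<tau> a b =
    (d_dir a (d_dir b \<xi>) \<tau> \<bullet> N \<tau> + (d_dir a \<xi> \<tau> \<bullet> d_dir b \<xi> \<tau>) * N \<tau> $ 3 / \<xi> \<tau> $ 3) / (\<xi> \<tau> $ 3)\<^sup>2"
  unfolding second_form_def metric_inner_hyp cov_deriv_hyp[where \<xi>=\<xi> and \<tau>=\<tau>, OF assms(1)]
  using assms by (simp add: inner_add_left inner_diff_left inner_axis' )

section \<open>Directional derivatives of smooth maps\<close>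

lemma smooth_on_subset: "smooth_on S f \<Longrightarrow> T \<subseteq> S \<Longrightarrow> smooth_on T f"
  unfolding smooth_on_def using Ck_on_subset by blast

lemma d_dir_eqI: "(\<xi> has_derivative D) (at \<tau>) \<Longrightarrow> d_dir a \<xi> \<tau> = D a"
  unfolding d_dir_def by (simp add: frechet_derivative_at[symmetric])

lemma has_derivative_d_dir:
  "\<xi> differentiable (at \<tau>) \<Longrightarrow> (\<xi> has_derivative (\<lambda>a. d_dir a \<xi> \<tau>)) (at \<tau>)"
  unfolding d_dir_def by (simp add: frechet_derivative_works)

lemma smooth_on_differentiable: "smooth_on S \<xi> \<Longrightarrow> x \<in> S \<Longrightarrow> \<xi> differentiable (at x)"
  unfolding smooth_on_def using Ck_on.simps(2) by blast

lemma smooth_on_d_dir: "smooth_on S \<xi> \<Longrightarrow> smooth_on S (d_dir a \<xi>)"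
  unfolding smooth_on_def d_dir_def[abs_def] using Ck_on_deriv by blast

lemma d_dir_decompose:
  assumes "\<xi> differentiable (at \<tau>)"
  shows "d_dir a \<xi> \<tau> = Re a *\<^sub>R d_u \<xi> \<tau> + Im a *\<^sub>R d_v \<xi> \<tau>"
proof -
  interpret bounded_linear "\<lambda>a. d_dir a \<xi> \<tau>"
    using has_derivative_d_dir[OF assms] by (rule has_derivative_bounded_linear)
  have "a = Re a *\<^sub>R 1 + Im a *\<^sub>R \<i>" by (simp add: complex_eq_iff)
  then have "d_dir a \<xi> \<tau> = d_dir (Re a *\<^sub>R 1 + Im a *\<^sub>R \<i>) \<xi> \<tau>"
    by (rule arg_cong)
  then show ?thesis by (simp only: add scaleR)
qed

section \<open>Congruences of horospheres\<close>

text \<open>The spheres have centre \<open>X\<close> and radius \<open>X $ 3\<close>, and \<open>\<xi>\<close> is an envelope. Differentiating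
  the tangency condition trades the second derivative of \<open>\<xi>\<close> for first derivatives of \<open>X\<close> and
  \<open>\<xi>\<close>; the Euclidean curvature \<open>1 / X $ 3\<close> of the sphere and the conformal correction then add
  up to the first fundamental form.\<close>

lemma second_form_horospheres:
  fixes X \<xi> :: "complex \<Rightarrow> real^3"
  assumes "open \<Omega>" "\<tau> \<in> \<Omega>" and \<xi>: "smooth_on \<Omega> \<xi>" and X: "smooth_on \<Omega> X"
    and pos: "\<xi> \<tau> $ 3 > 0" "X \<tau> $ 3 > 0"
    and orth: "\<And>\<sigma> b. \<sigma> \<in> \<Omega> \<Longrightarrow> d_dir b \<xi> \<sigma> \<bullet> (X \<sigma> - \<xi> \<sigma>) = 0"
    and N: "N \<tau> = (\<xi> \<tau> $ 3 / X \<tau> $ 3) *\<^sub>R (X \<tau> - \<xi> \<tau>)"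
  shows "second_form hyp_metric \<xi> N \<tau> a b =
    first_form hyp_metric \<xi> \<tau> a b - (d_dir a X \<tau> \<bullet> d_dir b \<xi> \<tau>) / (\<xi> \<tau> $ 3 * X \<tau> $ 3)"
proof -
  have "((\<lambda>\<sigma>. d_dir b \<xi> \<sigma> \<bullet> (X \<sigma> - \<xi> \<sigma>)) has_derivative
      (\<lambda>a. d_dir b \<xi> \<tau> \<bullet> (d_dir a X \<tau> - d_dir a \<xi> \<tau>) + d_dir a (d_dir b \<xi>) \<tau> \<bullet> (X \<tau> - \<xi> \<tau>))) (at \<tau>)"
    by (intro has_derivative_inner has_derivative_diff has_derivative_d_dir
        smooth_on_differentiable[OF _ \<open>\<tau> \<in> \<Omega>\<close>] smooth_on_d_dir \<xi> X)
  moreover have "((\<lambda>\<sigma>. d_dir b \<xi> \<sigma> \<bullet> (X \<sigma> - \<xi> \<sigma>)) has_derivative (\<lambda>a. 0)) (at \<tau>)"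
    by (rule has_derivative_transform_within_open[OF has_derivative_const[of 0] \<open>open \<Omega>\<close> \<open>\<tau> \<in> \<Omega>\<close>]) (simp add: orth)
  ultimately have "d_dir b \<xi> \<tau> \<bullet> (d_dir a X \<tau> - d_dir a \<xi> \<tau>) + d_dir a (d_dir b \<xi>) \<tau> \<bullet> (X \<tau> - \<xi> \<tau>) = 0"
    by (rule has_derivative_unique[THEN fun_cong])
  then have second: "d_dir a (d_dir b \<xi>) \<tau> \<bullet> (X \<tau> - \<xi> \<tau>) =
      d_dir a \<xi> \<tau> \<bullet> d_dir b \<xi> \<tau> - d_dir a X \<tau> \<bullet> d_dir b \<xi> \<tau>"
    by (simp add: inner_diff_right inner_commute)
  have "second_form hyp_metric \<xi> N \<tau> a b =
    (d_dir a (d_dir b \<xi>) \<tau> \<bullet> N \<tau> + (d_dir a \<xi> \<tau> \<bullet> d_dir b \<xi> \<tau>) * N \<tau> $ 3 / \<xi> \<tau> $ 3) / (\<xi> \<tau> $ 3)\<^sup>2"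
    by (rule second_form_hyp[where \<xi>=\<xi> and \<tau>=\<tau>, OF pos(1)]) (use orth[OF \<open>\<tau> \<in> \<Omega>\<close>] N in simp_all)
  also have "\<dots> = (d_dir a \<xi> \<tau> \<bullet> d_dir b \<xi> \<tau>) / (\<xi> \<tau> $ 3)\<^sup>2 - (d_dir a X \<tau> \<bullet> d_dir b \<xi> \<tau>) / (\<xi> \<tau> $ 3 * X \<tau> $ 3)"
    unfolding N inner_scaleR_right second using pos
    by (simp add: field_simps power2_eq_square)
  finally show ?thesis
    by (simp add: first_form_def metric_inner_hyp)
qed

text \<open>The tangency conditions leave two points on each sphere. Here \<open>(w, s)\<close> is the vector from
  the point of the envelope to the centre, \<open>r\<close> is the radius, \<open>c = f'\<close>, and the gradient of the
  radius is encoded by \<open>\<bar>c\<bar> A\<close>. For the first root the point lies on the plane \<open>z = 0\<close>; for the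
  second one its height is \<open>r - s = m\<close>.\<close>

lemma envelope_point_cases:
  fixes w c A :: complex and s r :: real
  assumes "c \<noteq> 0" and r: "r = (1 + (cmod A)\<^sup>2) * m / 2"
    and sphere: "(cmod w)\<^sup>2 + s\<^sup>2 = r\<^sup>2"
    and tangent: "\<And>a. Re (cnj w * (c * a)) + s * (cmod c * Re (cnj A * a)) = r * (cmod c * Re (cnj A * a))"
  shows "(w = 0 \<and> s = r) \<or> (w = m * sgn c * A \<and> r - s = m)"
proof -
  have "Re ((cnj w * c - (r - s) * cmod c * cnj A) * a) = 0" for a
    using tangent[of a] by (simp add: algebra_simps)
  from this[of 1] this[of \<i>] have "cnj w * c = (r - s) * cmod c * cnj A"
    by (simp add: complex_eq_iff)
  then have "cnj (cnj w * c) * c = cnj ((r - s) * cmod c * cnj A) * c"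
    by simp
  then have "w * (c * cnj c) = (r - s) * cmod c * c * A"
    by (simp add: mult_ac)
  then have "w * (cmod c)\<^sup>2 = (r - s) * cmod c * c * A"
    by (simp only: complex_norm_square flip: of_real_power)
  then have "of_real (cmod c) * (w * cmod c) = of_real (cmod c) * ((r - s) * c * A)"
    by (simp add: power2_eq_square mult_ac)
  then have "w * cmod c = (r - s) * c * A"
    by (rule mult_left_cancel[THEN iffD1, rotated]) (use \<open>c \<noteq> 0\<close> in simp)
  then have w: "w = (r - s) * sgn c * A"
    using \<open>c \<noteq> 0\<close> by (simp add: sgn_eq field_simps)
  have "(cmod w)\<^sup>2 = (r - s)\<^sup>2 * (cmod A)\<^sup>2"
    unfolding w using \<open>c \<noteq> 0\<close> by (simp add: norm_mult norm_sgn power_mult_distrib flip: of_real_diff)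
  then have "(r - s) * ((r - s) * (1 + (cmod A)\<^sup>2) - 2 * r) = 0"
    using sphere by (simp add: algebra_simps power2_eq_square)
  moreover have "2 * r = (1 + (cmod A)\<^sup>2) * m"
    unfolding r by simp
  ultimately have "(r - s) * ((r - s) * (1 + (cmod A)\<^sup>2) - (1 + (cmod A)\<^sup>2) * m) = 0"
    by (simp only:)
  then have "(r - s) * ((1 + (cmod A)\<^sup>2) * (r - s - m)) = 0"
    by algebra
  moreover have "1 + (cmod A)\<^sup>2 > 0" by (simp add: add_pos_nonneg)
  ultimately have "r = s \<or> r - s = m" by auto
  then show ?thesis using w by auto
qed

section \<open>The congruence of a holomorphic function\<close>

locale nonsingular_holomorphic =
  fixes \<Omega> :: "complex set" and f :: "complex \<Rightarrow> complex"
  assumes open_domain: "open \<Omega>" and holomorphic: "f holomorphic_on \<Omega>"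
    and deriv_nonzero: "\<And>\<tau>. \<tau> \<in> \<Omega> \<Longrightarrow> deriv f \<tau> \<noteq> 0"
begin

text \<open>Half the pre-Schwarzian derivative of \<open>f\<close>.\<close>

definition q :: "complex \<Rightarrow> complex" where
  "q \<tau> = deriv (deriv f) \<tau> / (2 * deriv f \<tau>)"

text \<open>Up to conjugation and the phase of \<open>f'\<close>, this is the stereographic coordinate, on the
  sphere, of the point of contact with the second envelope.\<close>

definition A :: "complex \<Rightarrow> complex" where
  "A \<tau> = \<tau> + (1 + \<tau> * cnj \<tau>) * cnj (q \<tau>)"

text \<open>The denominator of the second envelope divided by \<open>\<bar>f'\<bar>\<^sup>2\<close>. It is real, but kept complex
  and written with conjugates so that its derivative and its relations to \<open>A\<close> are polynomial
  identities in \<open>\<tau>\<close>, \<open>q\<close> and their conjugates.\<close>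

definition D :: "complex \<Rightarrow> complex" where
  "D \<tau> = (1 + \<tau> * q \<tau>) * cnj (1 + \<tau> * q \<tau>) + q \<tau> * cnj (q \<tau>)"

text \<open>Half the Schwarzian derivative of \<open>f\<close>.\<close>

definition S :: "complex \<Rightarrow> complex" where
  "S \<tau> = deriv q \<tau> - (q \<tau>)\<^sup>2"

definition R :: "complex \<Rightarrow> real" where
  "R \<tau> = (1 + (cmod \<tau>)\<^sup>2) / 2 * cmod (deriv f \<tau>)"

definition X :: "complex \<Rightarrow> real^3" where
  "X \<tau> = pt (f \<tau>) (R \<tau>)"

definition \<xi> :: "complex \<Rightarrow> real^3" where
  "\<xi> \<tau> = pt (f \<tau> - deriv f \<tau> * A \<tau> / D \<tau>) (cmod (deriv f \<tau>) / Re (D \<tau>))"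

lemma D_real: "D \<tau> = of_real (Re (D \<tau>))"
  by (simp add: D_def complex_eq_iff algebra_simps)

lemma Re_D: "Re (D \<tau>) = (cmod (1 + \<tau> * q \<tau>))\<^sup>2 + (cmod (q \<tau>))\<^sup>2"
  unfolding D_def by (simp flip: complex_norm_square del: complex_cnj_add complex_cnj_mult)

lemma Re_D_pos: "Re (D \<tau>) > 0"
proof (cases "q \<tau> = 0")
  case False
  then show ?thesis unfolding Re_D by (simp add: add_nonneg_pos)
qed (simp add: Re_D)

lemma D_nonzero: "D \<tau> \<noteq> 0"
  using Re_D_pos[of \<tau>] by auto

lemma cnj_D: "cnj (D \<tau>) = D \<tau>"
  by (simp add: D_def algebra_simps)

text \<open>By this identity the radius is \<open>(1 + \<bar>A\<bar>\<^sup>2) / 2\<close> times the height \<open>\<bar>f'\<bar> / D\<close> of \<open>\<xi>\<close>, and the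
  coefficient of \<open>cnj q'\<close> in the derivative of \<open>\<xi>\<close> reduces to \<open>- f' / D\<^sup>2\<close>.\<close>

lemma complex_norm_D: "(1 + \<tau> * cnj \<tau>) * D \<tau> = 1 + A \<tau> * cnj (A \<tau>)"
  unfolding A_def D_def by (simp add: algebra_simps)

lemma norm_D: "(1 + (cmod \<tau>)\<^sup>2) * Re (D \<tau>) = 1 + (cmod (A \<tau>))\<^sup>2"
proof -
  have "complex_of_real ((1 + (cmod \<tau>)\<^sup>2) * Re (D \<tau>)) = of_real (1 + (cmod (A \<tau>))\<^sup>2)"
    using complex_norm_D[of \<tau>] by (simp add: complex_norm_square flip: D_real del: of_real_power)
  then show ?thesis by (simp only: of_real_eq_iff)
qed

lemma holomorphic_q: "q holomorphic_on \<Omega>"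
  unfolding q_def[abs_def]
  by (intro holomorphic_intros holomorphic open_domain) (use deriv_nonzero in auto)

lemma has_derivative_holomorphic:
  "g holomorphic_on \<Omega> \<Longrightarrow> \<tau> \<in> \<Omega> \<Longrightarrow> (g has_derivative (\<lambda>a. deriv g \<tau> * a)) (at \<tau>)"
  using holomorphic_derivI[OF _ open_domain] by (simp add: has_field_derivative_def)

lemma deriv_deriv_f:
  "\<tau> \<in> \<Omega> \<Longrightarrow> deriv (deriv f) \<tau> = 2 * q \<tau> * deriv f \<tau>"
  by (simp add: q_def deriv_nonzero)

lemmas has_derivative_f = has_derivative_holomorphic[OF holomorphic]
lemmas has_derivative_f' = has_derivative_holomorphic[OF holomorphic_deriv[OF holomorphic open_domain]]
lemmas has_derivative_q = has_derivative_holomorphic[OF holomorphic_q]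

lemma has_derivative_A:
  assumes "\<tau> \<in> \<Omega>"
  shows "(A has_derivative (\<lambda>a. (1 + cnj \<tau> * cnj (q \<tau>)) * a
    + cnj ((deriv q \<tau> * (1 + \<tau> * cnj \<tau>) + cnj \<tau> * q \<tau>) * a))) (at \<tau>)"
  unfolding A_def[abs_def]
  by (rule derivative_eq_intros has_derivative_q assms refl)+ (simp add: algebra_simps)

lemma has_derivative_D:
  assumes "\<tau> \<in> \<Omega>"
  shows "(D has_derivative (\<lambda>a. (deriv q \<tau> * A \<tau> + q \<tau> * (1 + cnj \<tau> * cnj (q \<tau>))) * a
    + cnj ((deriv q \<tau> * A \<tau> + q \<tau> * (1 + cnj \<tau> * cnj (q \<tau>))) * a))) (at \<tau>)"
  unfolding D_def[abs_def]
  by (rule derivative_eq_intros has_derivative_q assms refl)+ (simp add: algebra_simps A_def)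

lemma has_derivative_cmod_f':
  assumes "\<tau> \<in> \<Omega>"
  shows "((\<lambda>\<tau>. cmod (deriv f \<tau>)) has_derivative (\<lambda>a. 2 * cmod (deriv f \<tau>) * Re (q \<tau> * a))) (at \<tau>)"
proof -
  let ?c = "deriv f \<tau>"
  have "((\<lambda>\<tau>. cmod (deriv f \<tau>)) has_derivative (\<lambda>a. inner (sgn ?c) (deriv (deriv f) \<tau> * a))) (at \<tau>)"
    using has_derivative_compose[OF has_derivative_f'[OF assms] has_derivative_norm[OF deriv_nonzero[OF assms]]]
    by (simp add: inner_commute)
  moreover have "inner (sgn ?c) (deriv (deriv f) \<tau> * a) = 2 * cmod ?c * Re (q \<tau> * a)" for a
  proof -
    have "inner (sgn ?c) (deriv (deriv f) \<tau> * a) = Re (cnj (sgn ?c) * (deriv (deriv f) \<tau> * a))"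
      by (simp add: inner_complex_def)
    also have "cnj (sgn ?c) * (deriv (deriv f) \<tau> * a) = (?c * cnj ?c) / cmod ?c * (2 * (q \<tau> * a))"
      by (simp add: deriv_deriv_f[OF assms] sgn_eq)
    also have "\<dots> = of_real (2 * cmod ?c) * (q \<tau> * a)"
      by (simp flip: complex_norm_square add: power2_eq_square deriv_nonzero[OF assms])
    finally show ?thesis by simp
  qed
  ultimately show ?thesis by simp
qed

lemma has_derivative_R:
  assumes "\<tau> \<in> \<Omega>"
  shows "(R has_derivative (\<lambda>a. cmod (deriv f \<tau>) * Re (cnj (A \<tau>) * a))) (at \<tau>)"
proof -
  have R: "R = (\<lambda>\<tau>. (1 + Re (\<tau> * cnj \<tau>)) / 2 * cmod (deriv f \<tau>))"
    by (simp add: R_def fun_eq_iff flip: complex_norm_square)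
  have "((\<lambda>\<tau>. (1 + Re (\<tau> * cnj \<tau>)) / 2) has_derivative (\<lambda>a. Re (cnj \<tau> * a))) (at \<tau>)"
    by (rule derivative_eq_intros refl | simp)+ (simp add: algebra_simps add_divide_distrib)
  from has_derivative_mult[OF this has_derivative_cmod_f'[OF assms]]
  have "(R has_derivative (\<lambda>a. (1 + Re (\<tau> * cnj \<tau>)) / 2 * (2 * cmod (deriv f \<tau>) * Re (q \<tau> * a))
      + Re (cnj \<tau> * a) * cmod (deriv f \<tau>))) (at \<tau>)"
    unfolding R .
  moreover have "Re (cnj (A \<tau>) * a) = Re (cnj \<tau> * a) + (1 + Re (\<tau> * cnj \<tau>)) * Re (q \<tau> * a)" for a
    by (simp add: A_def algebra_simps)
  ultimately show ?thesis
    by (simp del: times_complex.sel add: algebra_simps add_divide_distrib)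
qed

lemma has_derivative_X:
  assumes "\<tau> \<in> \<Omega>"
  shows "(X has_derivative (\<lambda>a. pt (deriv f \<tau> * a) (cmod (deriv f \<tau>) * Re (cnj (A \<tau>) * a)))) (at \<tau>)"
  unfolding X_def[abs_def] by (intro has_derivative_pt has_derivative_f has_derivative_R assms)

text \<open>With \<open>B = 1 + cnj \<tau> cnj q\<close> one has \<open>D = B + q A\<close>, \<open>\<partial>A = B\<close> and \<open>\<partial>D = q' A + q B\<close> for the
  derivatives in \<open>\<tau>\<close>. In the quotient rule for \<open>f' A / D\<close> the holomorphic part collapses to
  \<open>A\<^sup>2 S\<close> because \<open>D\<^sup>2 - (B + 2 q A) D + A \<partial>D = A\<^sup>2 S\<close>, and the antiholomorphic part to \<open>- cnj S\<close>
  by the relation \<open>cnj_S\<close> in the proof.\<close>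

lemma has_derivative_\<xi>:
  assumes "\<tau> \<in> \<Omega>"
  shows "(\<xi> has_derivative (\<lambda>a. (1 / (Re (D \<tau>))\<^sup>2) *\<^sub>R
     pt (deriv f \<tau> * ((A \<tau>)\<^sup>2 * (S \<tau> * a) - cnj (S \<tau> * a)))
        (- 2 * cmod (deriv f \<tau>) * Re (A \<tau> * (S \<tau> * a))))) (at \<tau>)"
proof -
  let ?c = "deriv f \<tau>"
  let ?B = "1 + cnj \<tau> * cnj (q \<tau>)"
  let ?b = "deriv q \<tau> * (1 + \<tau> * cnj \<tau>) + cnj \<tau> * q \<tau>"
  let ?A' = "\<lambda>a. ?B * a + cnj (?b * a)"
  let ?d = "\<lambda>a. (deriv q \<tau> * A \<tau> + q \<tau> * ?B) * a"
  have D: "D \<tau> = ?B + q \<tau> * A \<tau>"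
    by (simp add: A_def D_def algebra_simps)
  have cnj_S: "cnj ?b * D \<tau> - A \<tau> * cnj (deriv q \<tau> * A \<tau> + q \<tau> * ?B) = cnj (S \<tau>)"
  proof -
    have "cnj \<tau> * D \<tau> = cnj (A \<tau>) * ?B - q \<tau>"
      unfolding A_def D_def by (simp add: algebra_simps)
    then have "deriv q \<tau> * ((1 + \<tau> * cnj \<tau>) * D \<tau>) + q \<tau> * (cnj \<tau> * D \<tau>)
        = deriv q \<tau> * (1 + A \<tau> * cnj (A \<tau>)) + q \<tau> * (cnj (A \<tau>) * ?B - q \<tau>)"
      by (simp only: complex_norm_D)
    then have "?b * D \<tau> - cnj (A \<tau>) * (deriv q \<tau> * A \<tau> + q \<tau> * ?B) = S \<tau>"
      unfolding S_def by (simp add: algebra_simps power2_eq_square)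
    from arg_cong[OF this, of cnj] show ?thesis
      by (simp only: complex_cnj_diff complex_cnj_mult[of ?b "D \<tau>"] complex_cnj_mult[of "cnj (A \<tau>)"] complex_cnj_cnj cnj_D)
  qed
  have "((\<lambda>\<tau>. f \<tau> - deriv f \<tau> * A \<tau> / D \<tau>) has_derivative
     (\<lambda>a. ?c * a - ((?c * ?A' a + deriv (deriv f) \<tau> * a * A \<tau>) * D \<tau> - ?c * A \<tau> * (?d a + cnj (?d a))) / (D \<tau> * D \<tau>))) (at \<tau>)"
    by (intro has_derivative_diff has_derivative_divide' has_derivative_mult has_derivative_f has_derivative_f'
        has_derivative_A has_derivative_D assms D_nonzero)
  moreover have "?c * a - ((?c * ?A' a + deriv (deriv f) \<tau> * a * A \<tau>) * D \<tau> - ?c * A \<tau> * (?d a + cnj (?d a))) / (D \<tau> * D \<tau>)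
    = ?c * ((A \<tau>)\<^sup>2 * (S \<tau> * a) - cnj (S \<tau> * a)) / (D \<tau>)\<^sup>2" (is "?c * a - ?N / _ = ?M / _") for a
  proof -
    have "D \<tau> * D \<tau> - (?B + 2 * q \<tau> * A \<tau>) * D \<tau> + A \<tau> * (deriv q \<tau> * A \<tau> + q \<tau> * ?B) = (A \<tau>)\<^sup>2 * S \<tau>"
      unfolding D S_def by (simp add: algebra_simps power2_eq_square)
    from arg_cong[OF this, of "\<lambda>x. ?c * a * x"] cnj_S
    have "?c * a * (D \<tau> * D \<tau> - (?B + 2 * q \<tau> * A \<tau>) * D \<tau> + A \<tau> * (deriv q \<tau> * A \<tau> + q \<tau> * ?B))
       - ?c * cnj a * (cnj ?b * D \<tau> - A \<tau> * cnj (deriv q \<tau> * A \<tau> + q \<tau> * ?B)) = ?c * a * ((A \<tau>)\<^sup>2 * S \<tau>) - ?c * cnj a * cnj (S \<tau>)"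
      by (simp only:)
    (* Stated for variables: the expanded forms of A and D must not enter the normalization. *)
    moreover have "c * a * (D * D) - ((c * (B * a + b' * a') + 2 * q * c * a * A) * D - c * A * (e * a + e' * a'))
      = c * a * (D * D - (B + 2 * q * A) * D + A * e) - c * a' * (b' * D - A * e')" for a c D B b' a' q A e e' :: complex
      by (simp add: algebra_simps)
    ultimately have "?c * a * (D \<tau> * D \<tau>) - ?N = ?c * a * ((A \<tau>)\<^sup>2 * S \<tau>) - ?c * cnj a * cnj (S \<tau>)"
      unfolding deriv_deriv_f[OF assms] complex_cnj_mult[of _ a] by (simp only:)
    also have "\<dots> = ?M"
      by (simp add: algebra_simps)
    finally have "?c * a * (D \<tau> * D \<tau>) - ?N = ?M" .
    moreover have "?c * a - ?N / (D \<tau> * D \<tau>) = (?c * a * (D \<tau> * D \<tau>) - ?N) / (D \<tau> * D \<tau>)"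
      unfolding diff_divide_distrib using D_nonzero[of \<tau>] by simp
    ultimately show ?thesis
      by (simp only: power2_eq_square)
  qed
  ultimately have horizontal: "((\<lambda>\<tau>. f \<tau> - deriv f \<tau> * A \<tau> / D \<tau>) has_derivative
     (\<lambda>a. ?c * ((A \<tau>)\<^sup>2 * (S \<tau> * a) - cnj (S \<tau> * a)) / (D \<tau>)\<^sup>2)) (at \<tau>)"
    by (simp only:)
  have "((\<lambda>\<tau>. cmod (deriv f \<tau>) / Re (D \<tau>)) has_derivative
      (\<lambda>a. (2 * cmod ?c * Re (q \<tau> * a) * Re (D \<tau>) - cmod ?c * Re (?d a + cnj (?d a))) / (Re (D \<tau>) * Re (D \<tau>)))) (at \<tau>)"
    by (intro has_derivative_divide' has_derivative_Re has_derivative_cmod_f' has_derivative_D assms)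
      (use Re_D_pos[of \<tau>] in simp)
  moreover have "2 * cmod ?c * Re (q \<tau> * a) * Re (D \<tau>) - cmod ?c * Re (?d a + cnj (?d a))
      = - 2 * cmod ?c * Re (A \<tau> * (S \<tau> * a))" for a
  proof -
    have Re_of_real: "Re x * r = Re (x * of_real r)" and Re_cnj: "Re (x + cnj x) = 2 * Re x" for x r
      by simp_all
    have "q \<tau> * a * D \<tau> = ?d a - A \<tau> * (S \<tau> * a)"
      unfolding D S_def by (simp add: algebra_simps power2_eq_square)
    then have eq: "Re (q \<tau> * a) * Re (D \<tau>) = Re (?d a) - Re (A \<tau> * (S \<tau> * a))"
      by (simp only: Re_of_real D_real[symmetric] minus_complex.sel)
    have "2 * k * x * y - k * (2 * e) = - 2 * k * s" if "x * y = e - s" for k x y e s :: real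
      using that by algebra
    from this[OF eq] show ?thesis
      by (simp only: Re_cnj)
  qed
  ultimately have vertical: "((\<lambda>\<tau>. cmod (deriv f \<tau>) / Re (D \<tau>)) has_derivative
     (\<lambda>a. - 2 * cmod ?c * Re (A \<tau> * (S \<tau> * a)) / (Re (D \<tau>))\<^sup>2)) (at \<tau>)"
    by (simp only: power2_eq_square)
  have "complex_of_real (1 / (Re (D \<tau>))\<^sup>2) = 1 / (D \<tau>)\<^sup>2"
    by (simp flip: D_real)
  note scale = this
  show ?thesis
    unfolding \<xi>_def[abs_def] pt_scaleR scale
    by (rule has_derivative_eq_rhs[OF has_derivative_pt[OF horizontal vertical]])
      (simp only: times_divide_eq_left mult_1_left)
qed

text \<open>The height of the second envelope.\<close>

abbreviation m :: "complex \<Rightarrow> real" where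
  "m \<tau> \<equiv> cmod (deriv f \<tau>) / Re (D \<tau>)"

lemma m_pos: "\<tau> \<in> \<Omega> \<Longrightarrow> m \<tau> > 0"
  using Re_D_pos deriv_nonzero by simp

lemma R_eq: "R \<tau> = (1 + (cmod (A \<tau>))\<^sup>2) * m \<tau> / 2"
  unfolding R_def norm_D[symmetric] using Re_D_pos[of \<tau>] by simp

lemma R_minus_m: "R \<tau> - m \<tau> = m \<tau> * ((cmod (A \<tau>))\<^sup>2 - 1) / 2"
  unfolding R_eq by (simp add: algebra_simps add_divide_distrib)

lemma R_pos: "\<tau> \<in> \<Omega> \<Longrightarrow> R \<tau> > 0"
  unfolding R_def using deriv_nonzero by (simp add: add_pos_nonneg)

lemma X_minus_\<xi>: "X \<tau> - \<xi> \<tau> = pt (m \<tau> * sgn (deriv f \<tau>) * A \<tau>) (m \<tau> * ((cmod (A \<tau>))\<^sup>2 - 1) / 2)"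
proof -
  have "deriv f \<tau> * A \<tau> / D \<tau> = m \<tau> * sgn (deriv f \<tau>) * A \<tau>"
    by (subst D_real) (simp add: sgn_eq)
  then show ?thesis
    using R_minus_m[of \<tau>] by (simp add: X_def \<xi>_def pt_diff)
qed

lemma d_dir_X: "\<tau> \<in> \<Omega> \<Longrightarrow> d_dir a X \<tau> = pt (deriv f \<tau> * a) (cmod (deriv f \<tau>) * Re (cnj (A \<tau>) * a))"
  by (rule d_dir_eqI[OF has_derivative_X])

lemma d_dir_\<xi>:
  assumes "\<tau> \<in> \<Omega>"
  shows "d_dir a \<xi> \<tau> = (cmod (deriv f \<tau>) / (Re (D \<tau>))\<^sup>2) *\<^sub>R
    pt (sgn (deriv f \<tau>) * ((A \<tau>)\<^sup>2 * (S \<tau> * a) - cnj (S \<tau> * a))) (- 2 * Re (A \<tau> * (S \<tau> * a)))"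
  unfolding d_dir_eqI[OF has_derivative_\<xi>[OF assms]] pt_scaleR pt_eq_iff
  using deriv_nonzero[OF assms] by (simp add: sgn_eq del: times_complex.sel)

lemma tangent_orthogonal:
  assumes "\<tau> \<in> \<Omega>"
  shows "d_dir a \<xi> \<tau> \<bullet> (X \<tau> - \<xi> \<tau>) = 0"
proof -
  have "Re (cnj (z\<^sup>2 * s - cnj s) * (of_real k * z)) + (- 2 * Re (z * s)) * (k * ((cmod z)\<^sup>2 - 1) / 2) = 0" for z s k
    unfolding cmod_power2 by (simp add: power2_eq_square field_simps)
  note this[of "A \<tau>" "S \<tau> * a" "m \<tau>"]
  moreover have "X \<tau> - \<xi> \<tau> = pt (sgn (deriv f \<tau>) * (of_real (m \<tau>) * A \<tau>)) (m \<tau> * ((cmod (A \<tau>))\<^sup>2 - 1) / 2)"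
    unfolding X_minus_\<xi> by (simp only: mult_ac)
  ultimately show ?thesis
    unfolding d_dir_\<xi>[OF assms] by (simp only: inner_scaleR_left inner_rotated[OF deriv_nonzero[OF assms]] mult_zero_right)
qed

lemma norm_X_minus_\<xi>:
  assumes "\<tau> \<in> \<Omega>"
  shows "norm (X \<tau> - \<xi> \<tau>) = R \<tau>"
proof -
  have "Re (cnj (of_real k * z) * (of_real k * z)) + (k * ((cmod z)\<^sup>2 - 1) / 2) * (k * ((cmod z)\<^sup>2 - 1) / 2) = ((1 + (cmod z)\<^sup>2) * k / 2)\<^sup>2" for z k
    unfolding cmod_power2 by (simp add: power2_eq_square field_simps)
  note this[of "m \<tau>" "A \<tau>"]
  moreover have "X \<tau> - \<xi> \<tau> = pt (sgn (deriv f \<tau>) * (of_real (m \<tau>) * A \<tau>)) (m \<tau> * ((cmod (A \<tau>))\<^sup>2 - 1) / 2)"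
    unfolding X_minus_\<xi> by (simp only: mult_ac)
  ultimately have "(X \<tau> - \<xi> \<tau>) \<bullet> (X \<tau> - \<xi> \<tau>) = (R \<tau>)\<^sup>2"
    unfolding R_eq by (simp only: inner_rotated[OF deriv_nonzero[OF assms]])
  then show ?thesis
    using R_pos[OF assms] by (simp add: norm_eq_sqrt_inner)
qed

text \<open>The factor vanishes exactly at the zeros of the Schwarzian derivative, which are the
  singular points of \<open>\<xi>\<close>.\<close>

lemma conformal:
  assumes "\<tau> \<in> \<Omega>"
  shows "d_dir a \<xi> \<tau> \<bullet> d_dir b \<xi> \<tau> =
    (cmod (deriv f \<tau>) * (1 + (cmod (A \<tau>))\<^sup>2) * cmod (S \<tau>) / (Re (D \<tau>))\<^sup>2)\<^sup>2 * Re (cnj a * b)"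
proof -
  have "Re (cnj (z\<^sup>2 * s - cnj s) * (z\<^sup>2 * t - cnj t)) + (- 2 * Re (z * s)) * (- 2 * Re (z * t))
      = (1 + (cmod z)\<^sup>2)\<^sup>2 * Re (cnj s * t)" for z s t
    unfolding cmod_power2 by (simp add: power2_eq_square algebra_simps)
  note this[of "A \<tau>" "S \<tau> * a" "S \<tau> * b"]
  moreover have "Re (cnj (S \<tau> * a) * (S \<tau> * b)) = (cmod (S \<tau>))\<^sup>2 * Re (cnj a * b)"
    unfolding cmod_power2 by (simp add: power2_eq_square algebra_simps)
  ultimately show ?thesis
    unfolding d_dir_\<xi>[OF assms] inner_scaleR_left inner_scaleR_right inner_rotated[OF deriv_nonzero[OF assms]]
    by (simp only:) (simp add: power_mult_distrib power_divide power2_eq_square mult_ac del: times_complex.sel)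
qed

text \<open>In the sum over the directions \<open>1\<close> and \<open>\<i>\<close> the \<open>cnj S\<close> terms cancel, and the horizontal
  and vertical parts contribute \<open>2 Re (A\<^sup>2 S)\<close> with opposite signs.\<close>

lemma trace_zero:
  assumes "\<tau> \<in> \<Omega>"
  shows "d_u X \<tau> \<bullet> d_u \<xi> \<tau> + d_v X \<tau> \<bullet> d_v \<xi> \<tau> = 0"
proof -
  let ?c = "deriv f \<tau>" let ?r = "cmod ?c"
  have "d_dir a X \<tau> \<bullet> d_dir a \<xi> \<tau> = ?r / (Re (D \<tau>))\<^sup>2 * (?r *
     (Re (cnj a * ((A \<tau>)\<^sup>2 * (S \<tau> * a) - cnj (S \<tau> * a))) + Re (cnj (A \<tau>) * a) * (- 2 * Re (A \<tau> * (S \<tau> * a)))))" for a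
  proof -
    have "d_dir a X \<tau> = ?r *\<^sub>R pt (sgn ?c * a) (Re (cnj (A \<tau>) * a))"
      unfolding d_dir_X[OF assms] pt_scaleR pt_eq_iff
      using deriv_nonzero[OF assms] by (simp add: sgn_eq)
    then show ?thesis
      unfolding d_dir_\<xi>[OF assms] by (simp only: inner_scaleR_left inner_scaleR_right inner_rotated[OF deriv_nonzero[OF assms]])
  qed
  note inner = this
  have "(Re (cnj 1 * (z\<^sup>2 * (s * 1) - cnj (s * 1))) + Re (cnj z * 1) * (- 2 * Re (z * (s * 1))))
      + (Re (cnj \<i> * (z\<^sup>2 * (s * \<i>) - cnj (s * \<i>))) + Re (cnj z * \<i>) * (- 2 * Re (z * (s * \<i>)))) = 0" for z s
    by (simp add: power2_eq_square algebra_simps)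
  then show ?thesis
    unfolding inner distrib_left[symmetric] by (simp only: mult_zero_right)
qed

lemma Ck_on_holomorphic_data:
  "Ck_on k \<Omega> f" "Ck_on k \<Omega> (deriv f)" "Ck_on k \<Omega> q" "Ck_on k \<Omega> (\<lambda>\<tau>. \<tau>)"
  by (intro Ck_on_holomorphic open_domain holomorphic holomorphic_deriv holomorphic_q holomorphic_on_ident)+

lemmas Ck_on_intros = Ck_on_add[OF open_domain] Ck_on_const[OF open_domain]
  Ck_on_bilinear[OF open_domain bounded_bilinear_mult]
  Ck_on_linear[OF open_domain bounded_linear_cnj] Ck_on_linear[OF open_domain bounded_linear_Re]
  Ck_on_pt[OF open_domain] Ck_on_holomorphic_data

lemma Ck_on_A: "Ck_on k \<Omega> A"
  unfolding A_def[abs_def] by (intro Ck_on_intros)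

lemma Ck_on_D: "Ck_on k \<Omega> D"
  unfolding D_def[abs_def] by (intro Ck_on_intros)

lemma Ck_on_cmod_f': "Ck_on k \<Omega> (\<lambda>\<tau>. cmod (deriv f \<tau>))"
proof -
  have sq: "Re (deriv f \<tau> * cnj (deriv f \<tau>)) = (cmod (deriv f \<tau>))\<^sup>2" for \<tau>
    by (simp flip: complex_norm_square)
  (* The modulus is smooth away from 0 because it is the square root of a positive smooth map. *)
  have "Ck_on k \<Omega> (\<lambda>\<tau>. sqrt (Re (deriv f \<tau> * cnj (deriv f \<tau>))))"
  proof (intro Ck_on_sqrt Ck_on_intros open_domain)
    show "0 < Re (deriv f \<tau> * cnj (deriv f \<tau>))" if "\<tau> \<in> \<Omega>" for \<tau>
      unfolding sq using deriv_nonzero[OF that] by simp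
  qed
  then show ?thesis
    unfolding sq by simp
qed

lemma smooth_R: "smooth_on \<Omega> R"
proof -
  have R: "R = (\<lambda>\<tau>. (1 + Re (\<tau> * cnj \<tau>)) * (1 / 2) * cmod (deriv f \<tau>))"
    by (simp add: R_def fun_eq_iff flip: complex_norm_square)
  show ?thesis
    unfolding R smooth_on_def by (intro allI Ck_on_intros Ck_on_cmod_f')
qed

lemma smooth_X: "smooth_on \<Omega> X"
  using smooth_R unfolding smooth_on_def X_def[abs_def] by (intro allI Ck_on_intros) blast

lemma smooth_\<xi>: "smooth_on \<Omega> \<xi>"
proof -
  have "Re (D \<tau>) \<noteq> 0" for \<tau> using Re_D_pos[of \<tau>] by simp
  then show ?thesis
    unfolding smooth_on_def \<xi>_def[abs_def] divide_inverse
    by (intro allI Ck_on_intros Ck_on_diff[OF open_domain] Ck_on_inverse[OF open_domain] Ck_on_A Ck_on_D Ck_on_cmod_f' D_nonzero)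
qed

lemma sphere_congruence: "sphere_congruence_on \<Omega> X R"
  unfolding sphere_congruence_on_def
proof (intro conjI ballI smooth_X smooth_R R_pos)
  fix \<tau> assume "\<tau> \<in> \<Omega>"
  show "regular_at X \<tau>"
    unfolding regular_at_def
    using has_derivative_X[OF \<open>\<tau> \<in> \<Omega>\<close>] frechet_derivative_at[OF has_derivative_X[OF \<open>\<tau> \<in> \<Omega>\<close>], symmetric]
    by (auto simp: differentiable_def inj_on_def pt_eq_iff deriv_nonzero[OF \<open>\<tau> \<in> \<Omega>\<close>])
qed

lemma plane_envelope: "envelope_on \<Omega> X R (\<lambda>\<tau>. pt (f \<tau>) 0)"
  unfolding envelope_on_def
proof (intro conjI exI[of _ "\<lambda>_. pt 0 1"] ballI)
  show "smooth_on \<Omega> (\<lambda>\<tau>. pt (f \<tau>) 0)"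
    unfolding smooth_on_def by (intro allI Ck_on_intros)
  fix \<tau> assume "\<tau> \<in> \<Omega>"
  note d = d_dir_eqI[OF has_derivative_pt[OF has_derivative_f[OF this] has_derivative_const[of 0]]]
  show "norm (pt 0 1) = 1"
    by (simp add: norm_eq_sqrt_inner inner_pt)
  show "pt (f \<tau>) 0 = X \<tau> - R \<tau> *\<^sub>R pt 0 1"
    by (simp add: X_def pt_scaleR pt_diff)
  show "pt 0 1 \<bullet> d_u (\<lambda>\<tau>. pt (f \<tau>) 0) \<tau> = 0" "pt 0 1 \<bullet> d_v (\<lambda>\<tau>. pt (f \<tau>) 0) \<tau> = 0"
    by (simp_all add: d inner_pt)
qed

lemma second_envelope: "envelope_on \<Omega> X R \<xi>"
  unfolding envelope_on_def
proof (intro conjI exI[of _ "\<lambda>\<tau>. (1 / R \<tau>) *\<^sub>R (X \<tau> - \<xi> \<tau>)"] ballI smooth_\<xi>)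
  fix \<tau> assume \<tau>: "\<tau> \<in> \<Omega>"
  note R_pos[OF \<tau>]
  then show "norm ((1 / R \<tau>) *\<^sub>R (X \<tau> - \<xi> \<tau>)) = 1" "\<xi> \<tau> = X \<tau> - R \<tau> *\<^sub>R (1 / R \<tau>) *\<^sub>R (X \<tau> - \<xi> \<tau>)"
    by (simp_all add: norm_X_minus_\<xi>[OF \<tau>])
  show "(1 / R \<tau>) *\<^sub>R (X \<tau> - \<xi> \<tau>) \<bullet> d_u \<xi> \<tau> = 0" "(1 / R \<tau>) *\<^sub>R (X \<tau> - \<xi> \<tau>) \<bullet> d_v \<xi> \<tau> = 0"
    using tangent_orthogonal[OF \<tau>] by (simp_all add: inner_commute)
qed

lemma envelope_cases:
  assumes "envelope_on \<Omega> X R \<eta>" and \<tau>: "\<tau> \<in> \<Omega>"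
  shows "\<eta> \<tau> = pt (f \<tau>) 0 \<or> \<eta> \<tau> = \<xi> \<tau>"
proof -
  obtain \<nu> where smooth: "smooth_on \<Omega> \<eta>"
    and \<nu>: "\<And>\<tau>. \<tau> \<in> \<Omega> \<Longrightarrow> norm (\<nu> \<tau>) = 1" "\<And>\<tau>. \<tau> \<in> \<Omega> \<Longrightarrow> \<eta> \<tau> = X \<tau> - R \<tau> *\<^sub>R \<nu> \<tau>"
      "\<nu> \<tau> \<bullet> d_u \<eta> \<tau> = 0" "\<nu> \<tau> \<bullet> d_v \<eta> \<tau> = 0"
    using assms unfolding envelope_on_def by blast
  obtain w s where ws: "X \<tau> - \<eta> \<tau> = pt w s"
    by (rule pt_cases)
  have sphere: "(X \<sigma> - \<eta> \<sigma>) \<bullet> (X \<sigma> - \<eta> \<sigma>) = R \<sigma> * R \<sigma>" if "\<sigma> \<in> \<Omega>" for \<sigma>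
    using \<nu>(1)[OF that] by (simp add: \<nu>(2)[OF that] norm_eq_1)
  have diff: "X differentiable (at \<tau>)" "\<eta> differentiable (at \<tau>)"
    using smooth smooth_X \<tau> by (auto intro: smooth_on_differentiable)
  have orth: "(X \<tau> - \<eta> \<tau>) \<bullet> d_dir a \<eta> \<tau> = 0" for a
    using \<nu>(2)[OF \<tau>] \<nu>(3,4) by (simp add: d_dir_decompose[OF diff(2), of a] inner_add_right)
  let ?R' = "\<lambda>a. cmod (deriv f \<tau>) * Re (cnj (A \<tau>) * a)"
  have "((\<lambda>\<sigma>. (X \<sigma> - \<eta> \<sigma>) \<bullet> (X \<sigma> - \<eta> \<sigma>)) has_derivative
      (\<lambda>a. (X \<tau> - \<eta> \<tau>) \<bullet> (d_dir a X \<tau> - d_dir a \<eta> \<tau>) + (d_dir a X \<tau> - d_dir a \<eta> \<tau>) \<bullet> (X \<tau> - \<eta> \<tau>))) (at \<tau>)"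
    by (intro has_derivative_inner has_derivative_diff has_derivative_d_dir diff)
  moreover have "((\<lambda>\<sigma>. (X \<sigma> - \<eta> \<sigma>) \<bullet> (X \<sigma> - \<eta> \<sigma>)) has_derivative (\<lambda>a. R \<tau> * ?R' a + ?R' a * R \<tau>)) (at \<tau>)"
    by (rule has_derivative_transform_within_open[OF has_derivative_mult[OF has_derivative_R[OF \<tau>] has_derivative_R[OF \<tau>]] open_domain \<tau>])
      (simp add: sphere)
  ultimately have "(X \<tau> - \<eta> \<tau>) \<bullet> (d_dir a X \<tau> - d_dir a \<eta> \<tau>) + (d_dir a X \<tau> - d_dir a \<eta> \<tau>) \<bullet> (X \<tau> - \<eta> \<tau>)
      = R \<tau> * ?R' a + ?R' a * R \<tau>" for a
    by (rule has_derivative_unique[THEN fun_cong])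
  then have "(X \<tau> - \<eta> \<tau>) \<bullet> d_dir a X \<tau> = R \<tau> * ?R' a" for a
    unfolding inner_commute[of "d_dir _ X \<tau> - d_dir _ \<eta> \<tau>"]
    using orth by (simp add: inner_diff_right[of "X \<tau> - \<eta> \<tau>"] del: times_complex.sel)
  then have tangent: "Re (cnj w * (deriv f \<tau> * a)) + s * ?R' a = R \<tau> * ?R' a" for a
    unfolding ws d_dir_X[OF \<tau>] inner_pt .
  have "(cmod w)\<^sup>2 + s\<^sup>2 = (R \<tau>)\<^sup>2"
    using sphere[OF \<tau>] unfolding ws inner_pt cmod_power2 by (simp add: power2_eq_square)
  from envelope_point_cases[OF deriv_nonzero[OF \<tau>] R_eq this tangent]
  show ?thesis
  proof
    assume "w = 0 \<and> s = R \<tau>"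
    then have "X \<tau> - \<eta> \<tau> = X \<tau> - pt (f \<tau>) 0"
      unfolding ws by (simp add: X_def pt_diff)
    then show ?thesis by simp
  next
    assume *: "w = m \<tau> * sgn (deriv f \<tau>) * A \<tau> \<and> R \<tau> - s = m \<tau>"
    then have "s = R \<tau> - m \<tau>"
      by simp
    then have "X \<tau> - \<eta> \<tau> = X \<tau> - \<xi> \<tau>"
      unfolding X_minus_\<xi> ws pt_eq_iff R_minus_m[symmetric] using * by blast
    then show ?thesis by simp
  qed
qed

lemma height_pos: "\<tau> \<in> \<Omega> \<Longrightarrow> \<xi> \<tau> $ 3 > 0"
  using m_pos by (simp add: \<xi>_def)

lemma X_height: "X \<tau> $ 3 = R \<tau>"
  by (simp add: X_def)

text \<open>The Euclidean unit normal \<open>(X - \<xi>) / R\<close>, rescaled by the height to hyperbolic unit length.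
  It points into the horosphere, which makes the mean curvature \<open>+1\<close>.\<close>

definition N :: "complex \<Rightarrow> real^3" where
  "N \<tau> = (\<xi> \<tau> $ 3 / X \<tau> $ 3) *\<^sub>R (X \<tau> - \<xi> \<tau>)"

lemma smooth_N: "smooth_on \<Omega> N"
  unfolding smooth_on_def N_def[abs_def] divide_inverse
proof (intro allI Ck_on_bilinear[OF open_domain bounded_bilinear_scaleR] Ck_on_bilinear[OF open_domain bounded_bilinear_mult]
    Ck_on_inverse[OF open_domain] Ck_on_linear[OF open_domain bounded_linear_vec_nth] Ck_on_diff[OF open_domain])
  show "X \<tau> $ 3 \<noteq> 0" if "\<tau> \<in> \<Omega>" for \<tau>
    using R_pos[OF that] by (simp add: X_height)
qed (use smooth_X smooth_\<xi> in \<open>simp_all add: smooth_on_def\<close>)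

lemma unit_normal: "unit_normal_on hyp_metric \<Omega> \<xi> N"
  unfolding unit_normal_on_def metric_inner_hyp
proof (intro ballI conjI)
  fix \<tau> assume \<tau>: "\<tau> \<in> \<Omega>"
  have "(X \<tau> - \<xi> \<tau>) \<bullet> (X \<tau> - \<xi> \<tau>) = R \<tau> * R \<tau>"
    using norm_X_minus_\<xi>[OF \<tau>] by (metis power2_eq_square power2_norm_eq_inner)
  then show "N \<tau> \<bullet> N \<tau> / (\<xi> \<tau> $ 3)\<^sup>2 = 1"
    using R_pos[OF \<tau>] height_pos[OF \<tau>] by (simp add: N_def X_height power2_eq_square)
  show "d_u \<xi> \<tau> \<bullet> N \<tau> / (\<xi> \<tau> $ 3)\<^sup>2 = 0" "d_v \<xi> \<tau> \<bullet> N \<tau> / (\<xi> \<tau> $ 3)\<^sup>2 = 0"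
    using tangent_orthogonal[OF \<tau>] by (simp_all add: N_def)
qed

lemma mean_curvature_eq_1:
  assumes \<tau>: "\<tau> \<in> \<Omega>" and reg: "regular_at \<xi> \<tau>"
  shows "mean_curvature hyp_metric \<xi> N \<tau> = 1"
proof -
  let ?I = "first_form hyp_metric \<xi> \<tau>" let ?II = "second_form hyp_metric \<xi> N \<tau>"
  have conf: "?I \<i> \<i> = ?I 1 1" "?I 1 \<i> = 0"
    unfolding first_form_def metric_inner_hyp conformal[OF \<tau>] by simp_all
  have "d_u \<xi> \<tau> \<noteq> 0"
  proof
    assume "d_u \<xi> \<tau> = 0"
    moreover have "frechet_derivative \<xi> (at \<tau>) 0 = 0"
      using reg unfolding regular_at_def by (auto simp: frechet_derivative_works intro: linear_0 has_derivative_linear)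
    ultimately have "(1::complex) = 0"
      using reg unfolding regular_at_def d_dir_def by (metis injD)
    then show False by simp
  qed
  then have pos: "?I 1 1 > 0"
    using height_pos[OF \<tau>] by (simp add: first_form_def metric_inner_hyp)
  have II: "?II a b = ?I a b - (d_dir a X \<tau> \<bullet> d_dir b \<xi> \<tau>) / (\<xi> \<tau> $ 3 * X \<tau> $ 3)" for a b
    by (rule second_form_horospheres[where \<xi>=\<xi> and X=X and N=N, OF open_domain \<tau> smooth_\<xi> smooth_X height_pos[OF \<tau>] _ tangent_orthogonal N_def])
      (use R_pos[OF \<tau>] in \<open>simp_all add: X_height\<close>)
  have trace: "?II \<i> \<i> + ?II 1 1 = 2 * ?I 1 1"
  proof -
    have "d_v X \<tau> \<bullet> d_v \<xi> \<tau> = - (d_u X \<tau> \<bullet> d_u \<xi> \<tau>)"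
      using trace_zero[OF \<tau>] by simp
    then show ?thesis
      unfolding II conf by simp
  qed
  have "?I 1 1 * ?II \<i> \<i> + ?I 1 1 * ?II 1 1 = ?I 1 1 * (2 * ?I 1 1)"
    unfolding trace[symmetric] distrib_left ..
  then show ?thesis
    unfolding mean_curvature_def Let_def conf using pos
    by (simp add: power2_eq_square)
qed

lemma cmc_parametrization: "cmc_parametrization_on 1 \<Omega> \<xi>"
  unfolding cmc_parametrization_on_def cmc_immersion_on_def
  using smooth_\<xi> smooth_N height_pos unit_normal mean_curvature_eq_1
  by (auto simp: unit_normal_on_def intro!: exI[of _ N] intro: smooth_on_subset)

end

theorem theorem3p2:
  fixes \<Omega> :: "complex set" and f f1 f2 :: "complex \<Rightarrow> complex"
    and R den :: "complex \<Rightarrow> real" and X \<xi>0 \<xi> :: "complex \<Rightarrow> real^3"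
  assumes "open \<Omega>" and "f holomorphic_on \<Omega>"
    and "f1 = deriv f" and "f2 = deriv (deriv f)"
    and "\<forall>\<tau>\<in>\<Omega>. f1 \<tau> \<noteq> 0"
    and "R = (\<lambda>\<tau>. (1 + (cmod \<tau>)\<^sup>2) / 2 * cmod (f1 \<tau>))"
    and "X = (\<lambda>\<tau>. vector [Re (f \<tau>), Im (f \<tau>), R \<tau>])"
    and "\<xi>0 = (\<lambda>\<tau>. vector [Re (f \<tau>), Im (f \<tau>), 0])"
    and "den = (\<lambda>\<tau>. (cmod (f1 \<tau>))\<^sup>2 + Re (f1 \<tau> * cnj (f2 \<tau>) * cnj \<tau>)
                    + (cmod (f2 \<tau>))\<^sup>2 * ((cmod \<tau>)\<^sup>2 + 1) / 4)"
    and "\<xi> = (\<lambda>\<tau>. vector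
      [Re (f \<tau>) - ((cmod (f1 \<tau>))\<^sup>2 * Re (f1 \<tau> * \<tau>)
                     + (1 + (cmod \<tau>)\<^sup>2) / 2 * Re ((f1 \<tau>)\<^sup>2 * cnj (f2 \<tau>))) / den \<tau>,
       Im (f \<tau>) - ((cmod (f1 \<tau>))\<^sup>2 * Im (f1 \<tau> * \<tau>)
                     + (1 + (cmod \<tau>)\<^sup>2) / 2 * Im ((f1 \<tau>)\<^sup>2 * cnj (f2 \<tau>))) / den \<tau>,
       (cmod (f1 \<tau>)) ^ 3 / den \<tau>])"
  shows "sphere_congruence_on \<Omega> X R
    \<and> envelope_on \<Omega> X R \<xi>0
    \<and> envelope_on \<Omega> X R \<xi> \<and> (\<forall>\<tau>\<in>\<Omega>. \<xi> \<tau> \<noteq> \<xi>0 \<tau>)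
    \<and> (\<forall>\<eta>. envelope_on \<Omega> X R \<eta> \<longrightarrow> (\<forall>\<tau>\<in>\<Omega>. \<eta> \<tau> = \<xi>0 \<tau> \<or> \<eta> \<tau> = \<xi> \<tau>))
    \<and> cmc_parametrization_on 1 \<Omega> \<xi>"
proof -
  interpret G: nonsingular_holomorphic \<Omega> f
    using assms(1,2,3,5) by unfold_locales auto
  have R: "R = G.R"
    by (simp add: assms(3,6) fun_eq_iff G.R_def)
  have X: "X = G.X"
    by (simp add: assms(7) fun_eq_iff G.X_def pt_def R)
  have \<xi>0: "\<xi>0 = (\<lambda>\<tau>. pt (f \<tau>) 0)"
    by (simp add: assms(8) pt_def)
  have \<xi>: "\<xi> \<tau> = G.\<xi> \<tau>" for \<tau>
  proof (cases "f1 \<tau> = 0")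
    (* Such points lie outside \<Omega>; both formulas give (f, 0) there, since the numerators vanish. *)
    case True
    then show ?thesis
      by (simp add: assms(3,10) G.\<xi>_def pt_def)
  next
    case False
    define c where "c = f1 \<tau>"
    (* P is the complex form of the two numerators. *)
    define P where "P = of_real ((cmod c)\<^sup>2) * (c * \<tau>) + of_real ((1 + (cmod \<tau>)\<^sup>2) / 2) * (c\<^sup>2 * cnj (f2 \<tau>))"
    have f2: "f2 \<tau> = 2 * G.q \<tau> * c"
      using False by (simp add: G.q_def assms(3,4) c_def)
    have den: "den \<tau> = (cmod c)\<^sup>2 * Re (G.D \<tau>)"
      unfolding assms(9) c_def[symmetric] f2 G.Re_D norm_mult power_mult_distrib
      by (simp add: cmod_power2) (simp add: power2_eq_square algebra_simps)
    have "P = of_real ((cmod c)\<^sup>2) * (c * G.A \<tau>)"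
      unfolding P_def f2 G.A_def of_real_divide of_real_add complex_norm_square
      by (simp add: power2_eq_square algebra_simps)
    then have "P / of_real (den \<tau>) = c * G.A \<tau> / G.D \<tau>"
      using False by (simp add: den c_def flip: G.D_real)
    moreover have "cmod c ^ 3 / den \<tau> = cmod c / Re (G.D \<tau>)"
      using False by (simp add: den c_def power2_eq_square power3_eq_cube)
    ultimately have "G.\<xi> \<tau> = pt (f \<tau> - P / of_real (den \<tau>)) (cmod c ^ 3 / den \<tau>)"
      by (simp add: G.\<xi>_def c_def assms(3))
    moreover have "Re P = (cmod c)\<^sup>2 * Re (c * \<tau>) + (1 + (cmod \<tau>)\<^sup>2) / 2 * Re (c\<^sup>2 * cnj (f2 \<tau>))"
      "Im P = (cmod c)\<^sup>2 * Im (c * \<tau>) + (1 + (cmod \<tau>)\<^sup>2) / 2 * Im (c\<^sup>2 * cnj (f2 \<tau>))"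
    proof -
      have "Re (of_real r * z) = r * Re z" "Im (of_real r * z) = r * Im z" for r z
        by simp_all
      then show "Re P = (cmod c)\<^sup>2 * Re (c * \<tau>) + (1 + (cmod \<tau>)\<^sup>2) / 2 * Re (c\<^sup>2 * cnj (f2 \<tau>))"
        "Im P = (cmod c)\<^sup>2 * Im (c * \<tau>) + (1 + (cmod \<tau>)\<^sup>2) / 2 * Im (c\<^sup>2 * cnj (f2 \<tau>))"
        unfolding P_def by (simp_all only: plus_complex.sel)
    qed
    ultimately show ?thesis
      unfolding assms(10) pt_def c_def[symmetric]
      by (simp add: Re_divide_of_real Im_divide_of_real del: times_complex.sel)
  qed
  then have \<xi>: "\<xi> = G.\<xi>" ..
  have "G.\<xi> \<tau> \<noteq> pt (f \<tau>) 0" if "\<tau> \<in> \<Omega>" for \<tau>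
    using G.height_pos[OF that] by auto
  then show ?thesis
    unfolding R X \<xi>0 \<xi>
    using G.sphere_congruence G.plane_envelope G.second_envelope G.envelope_cases G.cmc_parametrization by blast
qed

end
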